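(* Let $L,n\in\mathbb{N}$ and define the waffle of size $L$ by $W_L=\{(i,j)\in\mathbb{N}^2 : j\le i\le L-j\}$. For $(i,j)\in W_L$, let $w_{n,i,j}$ be the number of square lattice walks of length $n$ in $W_L$ starting at $(i,j)$ and ending on the $x$-axis (i.e. at a point with second coordinate $0$). Then $$w_{n,i,j}=p_{n,i,j}-p_{n,i-1,j-1},$$ where $p_{n,i,j}$ is the number of forward (or equally backward) pyramid paths of length $n$ in $\mathcal{S}_{3,L}$ starting at the point $(i-j)e_1+je_2+(L-i)e_4$.
   Context: $\mathbb{N}=\{0,1,2,\dots\}$ and $(e_1,e_2,e_3,e_4)$ is the standard basis of $\mathbb{R}^4$. $\mathcal{S}_{3,L}=\{x_1e_1+x_2e_2+x_3e_3+x_4e_4 : x_1,x_2,x_3,x_4\in\mathbb{N},\ x_1+x_2+x_3+x_4=L\}$. Forward steps: $e_1-e_4,\ e_2-e_1,\ e_3-e_2,\ e_4-e_3$; backward steps are their opposites. A forward (resp. backward) pyramid path of length $n$ starting at $z$ is a sequence of $n$ forward (resp. backward) steps such that the starting point $z$ and all successive positions lie in $\mathcal{S}_{3,L}$; the number of such paths is $0$ if $z\notin\mathcal{S}_{3,L}$ (in particular $p_{n,i-1,j-1}=0$ when $j=0$). A square lattice walk in $W_L$ is a walk with steps $(1,0),(-1,0),(0,1),(0,-1)$ all of whose positions lie in $W_L$. *)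

theory Defs
  imports "HOL-Analysis.Analysis"
begin

text \<open>
  A walk is given by its list of steps; the case \<open>k = 0\<close> forces the starting point itself
  to lie in the domain, so there are no walks from a point outside it.
\<close>

definition walks :: "'a::monoid_add set \<Rightarrow> 'a set \<Rightarrow> nat \<Rightarrow> 'a \<Rightarrow> 'a list set" where
  "walks steps D n z =
    {ss. length ss = n \<and> set ss \<subseteq> steps \<and> (\<forall>k\<le>n. z + sum_list (take k ss) \<in> D)}"

abbreviation e :: "4 \<Rightarrow> real ^ 4" where
  "e k \<equiv> axis k 1"

definition pyramid :: "nat \<Rightarrow> (real ^ 4) set" where
  "pyramid L =
    {real x1 *\<^sub>R e 1 + real x2 *\<^sub>R e 2 + real x3 *\<^sub>R e 3 + real x4 *\<^sub>R e 4 | x1 x2 x3 x4 :: nat.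
      x1 + x2 + x3 + x4 = L}"

definition forward_steps :: "(real ^ 4) set" where
  "forward_steps = {e 1 - e 4, e 2 - e 1, e 3 - e 2, e 4 - e 3}"

definition backward_steps :: "(real ^ 4) set" where
  "backward_steps = uminus ` forward_steps"

definition forward_paths :: "nat \<Rightarrow> nat \<Rightarrow> real ^ 4 \<Rightarrow> (real ^ 4) list set" where
  "forward_paths L n z = walks forward_steps (pyramid L) n z"

definition backward_paths :: "nat \<Rightarrow> nat \<Rightarrow> real ^ 4 \<Rightarrow> (real ^ 4) list set" where
  "backward_paths L n z = walks backward_steps (pyramid L) n z"

text \<open>
  The indices are integers because the point with indices \<open>(i - 1, j - 1)\<close> is also needed
  when \<open>j = 0\<close>; it then has a negative second coordinate and lies outside the pyramid.
\<close>

definition start :: "nat \<Rightarrow> int \<Rightarrow> int \<Rightarrow> real ^ 4" where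
  "start L i j =
    real_of_int (i - j) *\<^sub>R e 1 + real_of_int j *\<^sub>R e 2 + real_of_int (int L - i) *\<^sub>R e 4"

definition p_forward :: "nat \<Rightarrow> nat \<Rightarrow> int \<Rightarrow> int \<Rightarrow> nat" where
  "p_forward L n i j = card (forward_paths L n (start L i j))"

definition p_backward :: "nat \<Rightarrow> nat \<Rightarrow> int \<Rightarrow> int \<Rightarrow> nat" where
  "p_backward L n i j = card (backward_paths L n (start L i j))"

definition waffle :: "nat \<Rightarrow> (int \<times> int) set" where
  "waffle L = {(i, j). 0 \<le> i \<and> 0 \<le> j \<and> j \<le> i \<and> i \<le> int L - j}"

definition square_steps :: "(int \<times> int) set" where
  "square_steps = {(1, 0), (-1, 0), (0, 1), (0, -1)}"

definition w :: "nat \<Rightarrow> nat \<Rightarrow> int \<Rightarrow> int \<Rightarrow> nat" where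
  "w L n i j =
    card {ss \<in> walks square_steps (waffle L) n (i, j). snd ((i, j) + sum_list ss) = 0}"

end

theory Submission imports Defs begin

text \<open>
  Let \<open>F\<close> and \<open>B\<close> be the operators that sum a function on the pyramid over the forward and
  the backward neighbours. They commute, and both map the constant function 1 to the number of
  nonzero coordinates, so \<open>F^n 1 = B^n 1\<close>: forward and backward paths are equinumerous from every
  starting point \<open>(a, b, c, d)\<close>. As exchanging \<open>b\<close> and \<open>d\<close> exchanges forward and backward
  steps, the number of paths is symmetric in \<open>b\<close> and \<open>d\<close>.

  Now expand \<open>p (n + 1) i j\<close> by its first forward step and \<open>p (n + 1) (i - 1) (j - 1)\<close> by its
  first backward step. The only terms off the face \<open>c = 0\<close> cancel, and what remains says that
  \<open>p n i j - p n (i - 1) (j - 1)\<close> satisfies the recursion of the square lattice walks. This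
  difference vanishes next to the waffle: on the side \<open>i + j = L + 1\<close> by the symmetry, and on the
  other sides because both points lie outside the pyramid.
\<close>

section \<open>Counting walks by their first step\<close>

lemma walks_0: "walks S D 0 z = (if z \<in> D then {[]} else {})"
  by (auto simp: walks_def)

lemma walks_outside: "z \<notin> D \<Longrightarrow> walks S D n z = {}"
  by (force simp: walks_def)

lemma Cons_in_walks_Suc:
  "s # ss \<in> walks S D (Suc n) z \<longleftrightarrow> z \<in> D \<and> s \<in> S \<and> ss \<in> walks S D n (z + s)"
proof -
  have "(\<forall>k\<le>Suc n. z + sum_list (take k (s # ss)) \<in> D) \<longleftrightarrow>
      z \<in> D \<and> (\<forall>k\<le>n. z + s + sum_list (take k ss) \<in> D)"
    by (simp flip: less_Suc_eq_le add: All_less_Suc2 add.assoc)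
  then show ?thesis by (auto simp: walks_def)
qed

lemma finite_walks: "finite S \<Longrightarrow> finite (walks S D n z)"
  by (rule finite_subset[OF _ finite_lists_length_eq[of S n]]) (auto simp: walks_def)

text \<open>The end condition \<open>Q\<close> lets one recursion serve both uses: trivial for
  pyramid paths, second coordinate 0 for waffle walks.\<close>

lemma card_walks_Suc_ending:
  assumes "finite S"
  shows "card {ss \<in> walks S D (Suc n) z. Q (z + sum_list ss)} =
    (if z \<in> D then \<Sum>s\<in>S. card {ss \<in> walks S D n (z + s). Q (z + s + sum_list ss)} else 0)"
proof -
  let ?A = "\<lambda>s. {ss \<in> walks S D n (z + s). Q (z + s + sum_list ss)}"
  let ?W = "{ss \<in> walks S D (Suc n) z. Q (z + sum_list ss)}"
  have mem: "ss \<in> ?W \<longleftrightarrow> z \<in> D \<and> ss \<in> (\<Union>s\<in>S. (#) s ` ?A s)" for ss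
  proof (cases ss)
    case Nil
    then show ?thesis by (auto simp: walks_def)
  next
    case (Cons s ts)
    then show ?thesis by (auto simp: Cons_in_walks_Suc add.assoc)
  qed
  show ?thesis
  proof (cases "z \<in> D")
    case True
    then have "?W = (\<Union>s\<in>S. (#) s ` ?A s)" using mem by blast
    also have "card \<dots> = (\<Sum>s\<in>S. card ((#) s ` ?A s))"
      using assms by (intro card_UN_disjoint) (auto simp: finite_walks)
    also have "\<dots> = (\<Sum>s\<in>S. card (?A s))"
      by (intro sum.cong refl card_image) simp
    finally show ?thesis using True by simp
  next
    case False
    then have "?W = {}" using mem by blast
    then show ?thesis using False by (simp only: if_False card.empty)
  qed
qed

text \<open>The transfer operator of the walks: the value 0 outside \<open>D\<close> discards walks
  that leave \<open>D\<close>, so its iterates on the indicator of \<open>D\<close> count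
  walks.\<close>

definition step_sum :: "'a::monoid_add set \<Rightarrow> 'a set \<Rightarrow> ('a \<Rightarrow> nat) \<Rightarrow> 'a \<Rightarrow> nat" where
  "step_sum S D f x = (if x \<in> D then \<Sum>s\<in>S. f (x + s) else 0)"

lemma card_walks:
  assumes "finite S"
  shows "card (walks S D n x) = (step_sum S D ^^ n) (indicator D) x"
proof (induction n arbitrary: x)
  case 0
  then show ?case by (simp add: walks_0)
next
  case (Suc n)
  show ?case
    using card_walks_Suc_ending[OF assms, of D n x "\<lambda>_. True"] Suc by (simp add: step_sum_def)
qed

lemma card_walks_Suc:
  "finite S \<Longrightarrow> card (walks S D (Suc n) x) = step_sum S D (\<lambda>y. card (walks S D n y)) x"
  by (simp add: card_walks)

section \<open>Walks and walks with opposite steps\<close>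

text \<open>Both sides sum \<open>f (x + s - t)\<close> over pairs of steps, passing through
  \<open>x + s\<close> or \<open>x - t\<close>. For \<open>s \<noteq> t\<close>, \<open>swap\<close>
  trades the intermediate points when the end lies in \<open>D\<close>, and \<open>supp\<close>
  kills all other ends. For \<open>s = t\<close> the walk returns to \<open>x\<close>, and
  \<open>deg\<close> equates the numbers of round trips.\<close>

lemma step_sum_commute:
  fixes S D :: "'a::ab_group_add set"
  assumes "finite S"
    and supp: "\<And>x. x \<notin> D \<Longrightarrow> f x = 0"
    and swap: "\<And>x s t. \<lbrakk>x \<in> D; s \<in> S; t \<in> S; s \<noteq> t; x + s - t \<in> D\<rbrakk> \<Longrightarrow> x + s \<in> D \<longleftrightarrow> x - t \<in> D"
    and deg: "\<And>x. x \<in> D \<Longrightarrow> (\<Sum>s\<in>S. indicator D (x + s)) = (\<Sum>s\<in>S. indicator D (x - s) :: nat)"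
  shows "step_sum S D (step_sum (uminus ` S) D f) = step_sum (uminus ` S) D (step_sum S D f)"
proof
  fix x
  have neg: "(\<Sum>t\<in>uminus ` S. g t) = (\<Sum>t\<in>S. g (- t))" for g :: "'a \<Rightarrow> nat"
    by (simp add: sum.reindex)
  have diag: "(\<Sum>s\<in>S. \<Sum>t\<in>S. h s t) = (\<Sum>s\<in>S. h s s) + (\<Sum>s\<in>S. \<Sum>t\<in>S - {s}. h s t)"
    for h :: "'a \<Rightarrow> 'a \<Rightarrow> nat"
    using assms(1) by (simp add: sum.remove flip: sum.distrib)
  show "step_sum S D (step_sum (uminus ` S) D f) x = step_sum (uminus ` S) D (step_sum S D f) x"
  proof (cases "x \<in> D")
    case True
    have "step_sum S D (step_sum (uminus ` S) D f) x =
        (\<Sum>s\<in>S. \<Sum>t\<in>S. indicator D (x + s) * f (x + s - t))"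
      using True by (auto simp: step_sum_def neg sum_distrib_left intro!: sum.cong)
    also have "\<dots> = (\<Sum>s\<in>S. indicator D (x + s)) * f x +
        (\<Sum>s\<in>S. \<Sum>t\<in>S - {s}. indicator D (x + s) * f (x + s - t))"
      by (simp add: diag sum_distrib_right)
    also have "(\<Sum>s\<in>S. \<Sum>t\<in>S - {s}. indicator D (x + s) * f (x + s - t)) =
        (\<Sum>s\<in>S. \<Sum>t\<in>S - {s}. indicator D (x - t) * f (x + s - t))"
    proof (intro sum.cong refl)
      fix s t assume "s \<in> S" "t \<in> S - {s}"
      then show "indicator D (x + s) * f (x + s - t) = indicator D (x - t) * f (x + s - t)"
        using swap[of x s t] supp[of "x + s - t"] True
        by (cases "x + s - t \<in> D") (auto simp: indicator_def)
    qed
    also have "(\<Sum>s\<in>S. indicator D (x + s)) * f x +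
        (\<Sum>s\<in>S. \<Sum>t\<in>S - {s}. indicator D (x - t) * f (x + s - t)) =
        (\<Sum>s\<in>S. \<Sum>t\<in>S. indicator D (x - t) * f (x + s - t))"
      by (simp add: deg[OF True] diag sum_distrib_right)
    also have "\<dots> = (\<Sum>t\<in>S. \<Sum>s\<in>S. indicator D (x - t) * f (x + s - t))"
      by (rule sum.swap)
    also have "\<dots> = step_sum (uminus ` S) D (step_sum S D f) x"
      using True by (auto simp: step_sum_def neg sum_distrib_left algebra_simps intro!: sum.cong)
    finally show ?thesis .
  qed (simp add: step_sum_def)
qed

lemma card_walks_uminus:
  fixes S D :: "'a::ab_group_add set"
  assumes "finite S"
    and swap: "\<And>x s t. \<lbrakk>x \<in> D; s \<in> S; t \<in> S; s \<noteq> t; x + s - t \<in> D\<rbrakk> \<Longrightarrow> x + s \<in> D \<longleftrightarrow> x - t \<in> D"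
    and deg: "\<And>x. x \<in> D \<Longrightarrow> (\<Sum>s\<in>S. indicator D (x + s)) = (\<Sum>s\<in>S. indicator D (x - s) :: nat)"
  shows "card (walks (uminus ` S) D n x) = card (walks S D n x)"
proof -
  let ?F = "step_sum S D" and ?B = "step_sum (uminus ` S) D" and ?one = "indicator D"
  have one: "?B ?one = ?F ?one"
    using deg by (auto simp: step_sum_def fun_eq_iff sum.reindex)
  have supp: "(?F ^^ m) ?one y = 0" if "y \<notin> D" for m y
    using that by (cases m) (auto simp: step_sum_def)
  \<comment> \<open>\<open>?B\<close> moves inward past every \<open>?F\<close> and turns into
    \<open>?F\<close> at the indicator, by \<open>one\<close>.\<close>
  have comm: "?B ((?F ^^ m) ?one) = (?F ^^ Suc m) ?one" for m
  proof (induction m)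
    case (Suc m)
    have "?B (?F ((?F ^^ m) ?one)) = ?F (?B ((?F ^^ m) ?one))"
      using step_sum_commute[of S D "(?F ^^ m) ?one"] assms supp by metis
    then show ?case using Suc by simp
  qed (simp add: one)
  have "(?B ^^ n) ?one = (?F ^^ n) ?one"
    by (induction n) (simp_all add: comm)
  then show ?thesis
    using assms(1) by (simp add: card_walks)
qed

section \<open>Paths in the pyramid\<close>

text \<open>Integer coordinates also name the neighbours outside the pyramid and keep differences
  exact.\<close>

definition pt :: "int \<Rightarrow> int \<Rightarrow> int \<Rightarrow> int \<Rightarrow> real ^ 4" where
  "pt a b c d = of_int a *\<^sub>R e 1 + of_int b *\<^sub>R e 2 + of_int c *\<^sub>R e 3 + of_int d *\<^sub>R e 4"

lemma distinct_4: "distinct [1, 2, 3, 4 :: 4]"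
  by simp

lemma pt_nth: "pt a b c d $ 1 = a" "pt a b c d $ 2 = b" "pt a b c d $ 3 = c" "pt a b c d $ 4 = d"
  using distinct_4 by (simp_all add: pt_def axis_def)

lemma pt_eq_iff: "pt a b c d = pt a' b' c' d' \<longleftrightarrow> a = a' \<and> b = b' \<and> c = c' \<and> d = d'"
  by (simp add: vec_eq_iff forall_4 pt_nth)

lemma pyramid_alt:
  "pyramid L = {pt a b c d | a b c d. 0 \<le> a \<and> 0 \<le> b \<and> 0 \<le> c \<and> 0 \<le> d \<and> a + b + c + d = int L}"
  (is "_ = ?R")
proof
  show "pyramid L \<subseteq> ?R"
  proof
    fix x assume "x \<in> pyramid L"
    then obtain x1 x2 x3 x4 where "x1 + x2 + x3 + x4 = L"
      and "x = real x1 *\<^sub>R e 1 + real x2 *\<^sub>R e 2 + real x3 *\<^sub>R e 3 + real x4 *\<^sub>R e 4"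
      by (auto simp: pyramid_def)
    then have "x = pt (int x1) (int x2) (int x3) (int x4)" "int x1 + int x2 + int x3 + int x4 = int L"
      by (auto simp: pt_def)
    then show "x \<in> ?R" by force
  qed
  show "?R \<subseteq> pyramid L"
  proof
    fix x assume "x \<in> ?R"
    then obtain a b c d where "x = pt a b c d" "0 \<le> a" "0 \<le> b" "0 \<le> c" "0 \<le> d" "a + b + c + d = int L"
      by blast
    then show "x \<in> pyramid L"
      unfolding pyramid_def pt_def
      by (intro CollectI exI[of _ "nat a"] exI[of _ "nat b"] exI[of _ "nat c"] exI[of _ "nat d"]) auto
  qed
qed

lemma pt_in_pyramid:
  "pt a b c d \<in> pyramid L \<longleftrightarrow> 0 \<le> a \<and> 0 \<le> b \<and> 0 \<le> c \<and> 0 \<le> d \<and> a + b + c + d = int L"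
  by (auto simp: pyramid_alt pt_eq_iff)

lemma forward_steps_pt:
  "forward_steps = {pt 1 0 0 (- 1), pt (- 1) 1 0 0, pt 0 (- 1) 1 0, pt 0 0 (- 1) 1}"
  by (simp add: forward_steps_def pt_def)

lemma pt_add: "pt a b c d + pt a' b' c' d' = pt (a + a') (b + b') (c + c') (d + d')"
  by (simp add: pt_def algebra_simps)

lemma pt_diff: "pt a b c d - pt a' b' c' d' = pt (a - a') (b - b') (c - c') (d - d')"
  by (simp add: pt_def algebra_simps)

lemma finite_forward_steps: "finite forward_steps"
  by (simp add: forward_steps_pt)

lemma sum_forward_steps:
  "(\<Sum>s\<in>forward_steps. f s) =
    f (pt 1 0 0 (- 1)) + f (pt (- 1) 1 0 0) + f (pt 0 (- 1) 1 0) + f (pt 0 0 (- 1) 1)"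
  for f :: "_ \<Rightarrow> 'a::comm_monoid_add"
  by (simp add: forward_steps_pt pt_eq_iff add.assoc)

lemma sum_backward_steps: "(\<Sum>s\<in>backward_steps. f s) = (\<Sum>s\<in>forward_steps. f (- s))"
  by (simp add: backward_steps_def sum.reindex)

definition paths :: "nat \<Rightarrow> nat \<Rightarrow> int \<Rightarrow> int \<Rightarrow> int \<Rightarrow> int \<Rightarrow> nat" where
  "paths L n a b c d = card (forward_paths L n (pt a b c d))"

lemma card_backward_paths: "card (backward_paths L n x) = card (forward_paths L n x)"
  unfolding backward_paths_def forward_paths_def backward_steps_def
proof (rule card_walks_uminus[OF finite_forward_steps])
  fix x s t
  assume "x \<in> pyramid L" "s \<in> forward_steps" "t \<in> forward_steps" "s \<noteq> t" "x + s - t \<in> pyramid L"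
  \<comment> \<open>The coordinate lowered by \<open>s\<close> is raised only by \<open>- s\<close>
    among the reversed steps, and likewise for \<open>- t\<close>. So for
    \<open>s \<noteq> t\<close> a valid end forces both intermediate points into the
    pyramid.\<close>
  then show "x + s \<in> pyramid L \<longleftrightarrow> x - t \<in> pyramid L"
    unfolding pyramid_alt[of L] forward_steps_pt
    by (auto simp: pt_add pt_diff pt_eq_iff)
next
  fix x assume x: "x \<in> pyramid L"
  then obtain a b c d where "x = pt a b c d"
    by (auto simp: pyramid_alt)
  \<comment> \<open>Each coordinate is lowered by exactly one forward and one backward step, so both
    sums count the nonzero coordinates.\<close>
  with x show "(\<Sum>s\<in>forward_steps. indicator (pyramid L) (x + s)) =
      (\<Sum>s\<in>forward_steps. indicator (pyramid L) (x - s) :: nat)"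
    by (simp add: sum_forward_steps pt_add pt_diff pt_in_pyramid indicator_def)
qed

lemma paths_outside: "pt a b c d \<notin> pyramid L \<Longrightarrow> paths L n a b c d = 0"
  by (simp add: paths_def forward_paths_def walks_outside)

lemma paths_0: "paths L 0 a b c d = of_bool (pt a b c d \<in> pyramid L)"
  by (simp add: paths_def forward_paths_def walks_0)

lemma paths_Suc_forward:
  assumes "pt a b c d \<in> pyramid L"
  shows "paths L (Suc n) a b c d = paths L n (a + 1) b c (d - 1) + paths L n (a - 1) (b + 1) c d
    + paths L n a (b - 1) (c + 1) d + paths L n a b (c - 1) (d + 1)"
  using assms unfolding paths_def forward_paths_def card_walks_Suc[OF finite_forward_steps]
  by (simp add: step_sum_def sum_forward_steps pt_add)

text \<open>Although \<open>paths\<close> counts forward paths, \<open>card_backward_paths\<close>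
  permits expanding it by a backward step as well.\<close>

lemma paths_Suc_backward:
  assumes "pt a b c d \<in> pyramid L"
  shows "paths L (Suc n) a b c d = paths L n (a - 1) b c (d + 1) + paths L n (a + 1) (b - 1) c d
    + paths L n a (b + 1) (c - 1) d + paths L n a b (c + 1) (d - 1)"
proof -
  have "finite backward_steps"
    by (simp add: backward_steps_def finite_forward_steps)
  from card_walks_Suc[OF this, of "pyramid L" n "pt a b c d"] show ?thesis
    using assms unfolding paths_def card_backward_paths[symmetric] backward_paths_def
    by (simp add: step_sum_def sum_backward_steps sum_forward_steps pt_diff)
qed

lemma paths_swap: "paths L n a b c d = paths L n a d c b"
proof (induction n arbitrary: a b c d)
  case 0
  then show ?case by (auto simp: paths_0 pt_in_pyramid)
next
  case (Suc n)
  show ?case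
  proof (cases "pt a b c d \<in> pyramid L")
    case True
    then have swapped: "pt a d c b \<in> pyramid L" by (auto simp: pt_in_pyramid)
    \<comment> \<open>One side is expanded forward and the other backward; the four terms then match
      in pairs under the exchange.\<close>
    show ?thesis
      using Suc[of "a + 1" b c "d - 1"] Suc[of "a - 1" "b + 1" c d]
        Suc[of a "b - 1" "c + 1" d] Suc[of a b "c - 1" "d + 1"]
      by (simp add: paths_Suc_forward[OF True] paths_Suc_backward[OF swapped])
  next
    case False
    moreover from False have "pt a d c b \<notin> pyramid L" by (auto simp: pt_in_pyramid)
    ultimately show ?thesis by (simp add: paths_outside)
  qed
qed

section \<open>Walks in the waffle\<close>

lemma w_outside: "(i, j) \<notin> waffle L \<Longrightarrow> w L n i j = 0"
  by (simp add: w_def walks_outside)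

lemma w_0: "(i, j) \<in> waffle L \<Longrightarrow> w L 0 i j = of_bool (j = 0)"
  by (simp add: w_def walks_0 cong: conj_cong)

lemma w_Suc:
  assumes "(i, j) \<in> waffle L"
  shows "w L (Suc n) i j = w L n (i + 1) j + w L n (i - 1) j + w L n i (j + 1) + w L n i (j - 1)"
proof -
  have "finite square_steps" by (simp add: square_steps_def)
  from card_walks_Suc_ending[OF this, of "waffle L" n "(i, j)" "\<lambda>x. snd x = 0"] show ?thesis
    using assms unfolding w_def by (simp add: square_steps_def)
qed

definition face_paths :: "nat \<Rightarrow> nat \<Rightarrow> int \<Rightarrow> int \<Rightarrow> int" where
  "face_paths L n i j = int (paths L n (i - j) j 0 (int L - i))"

lemma p_forward_eq: "int (p_forward L n i j) = face_paths L n i j"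
  by (simp add: face_paths_def paths_def p_forward_def start_def pt_def)

lemma face_paths_outside: "j < 0 \<or> i < j \<or> int L < i \<Longrightarrow> face_paths L n i j = 0"
  by (auto simp: face_paths_def pt_in_pyramid intro!: paths_outside)

text \<open>The three inequalities allow one step beyond each side of the waffle, which covers all
  neighbours of its points.\<close>

lemma face_paths_diff_boundary:
  assumes "(i, j) \<notin> waffle L" "j \<le> i + 1" "- 1 \<le> j" "i + j \<le> int L + 1"
  shows "face_paths L n i j = face_paths L n (i - 1) (j - 1)"
proof (cases "j = - 1 \<or> i = j - 1")
  case True
  then show ?thesis by (auto simp: face_paths_outside)
next
  case False
  \<comment> \<open>Only the side \<open>i + j = L + 1\<close> is left, where the two starting
    points are exchanged by \<open>paths_swap\<close>.\<close>
  with assms have "int L - i = j - 1"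
    by (auto simp: waffle_def)
  then have eqs: "int L - i = j - 1" "int L - (i - 1) = j" "i - 1 - (j - 1) = i - j" by simp_all
  show ?thesis
    unfolding face_paths_def eqs by (simp only: paths_swap[of L n "i - j" j 0 "j - 1"])
qed

lemma face_paths_diff_Suc:
  assumes "(i, j) \<in> waffle L"
  shows "face_paths L (Suc n) i j - face_paths L (Suc n) (i - 1) (j - 1) =
    face_paths L n (i + 1) j + face_paths L n i (j + 1)
    - face_paths L n (i - 2) (j - 1) - face_paths L n (i - 1) (j - 2)"
proof -
  \<comment> \<open>The common neighbour off the face: one forward step from the first starting
    point, one backward step from the second.\<close>
  let ?off = "int (paths L n (i - j) (j - 1) 1 (int L - i))"
  have zero: "paths L n a b (- 1) d = 0" for a b d
    by (simp add: paths_outside pt_in_pyramid)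
  have "pt (i - j) j 0 (int L - i) \<in> pyramid L"
    using assms by (auto simp: pt_in_pyramid waffle_def)
  from paths_Suc_forward[OF this, of n]
  have 1: "face_paths L (Suc n) i j = face_paths L n (i + 1) j + face_paths L n i (j + 1) + ?off"
    by (simp add: face_paths_def zero algebra_simps)
  have 2: "face_paths L (Suc n) (i - 1) (j - 1) =
      face_paths L n (i - 2) (j - 1) + face_paths L n (i - 1) (j - 2) + ?off"
  \<comment> \<open>For \<open>j = 0\<close> every term, \<open>?off\<close> included, starts at a
    negative second coordinate and vanishes.\<close>
  proof (cases "j = 0")
    case True
    then show ?thesis by (simp add: face_paths_outside paths_outside pt_in_pyramid)
  next
    case False
    then have "pt (i - j) (j - 1) 0 (int L - i + 1) \<in> pyramid L"
      using assms by (auto simp: pt_in_pyramid waffle_def)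
    from paths_Suc_backward[OF this, of n] show ?thesis
      by (simp add: face_paths_def zero algebra_simps)
  qed
  show ?thesis using 1 2 by simp
qed

lemma w_eq_face_paths_diff:
  assumes "(i, j) \<in> waffle L"
  shows "int (w L n i j) = face_paths L n i j - face_paths L n (i - 1) (j - 1)"
  using assms
proof (induction n arbitrary: i j)
  case 0
  \<comment> \<open>In the waffle, the second starting point leaves the pyramid exactly when
    \<open>j = 0\<close>.\<close>
  then show ?case
    by (auto simp: w_0 face_paths_def paths_0 pt_in_pyramid waffle_def)
next
  case (Suc n)
  \<comment> \<open>Neighbours outside the waffle are included: there both sides are 0.\<close>
  have nbr: "int (w L n i' j') = face_paths L n i' j' - face_paths L n (i' - 1) (j' - 1)"
    if "\<bar>i' - i\<bar> + \<bar>j' - j\<bar> = 1" for i' j'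
  proof (cases "(i', j') \<in> waffle L")
    case False
    moreover have "j' \<le> i' + 1" "- 1 \<le> j'" "i' + j' \<le> int L + 1"
      using Suc.prems that by (auto simp: waffle_def)
    ultimately show ?thesis
      using face_paths_diff_boundary by (simp add: w_outside)
  qed (rule Suc.IH)
  \<comment> \<open>Summed over the four neighbours, the terms at \<open>(i - 1, j)\<close> and
    \<open>(i, j - 1)\<close> cancel, leaving the right-hand side of
    \<open>face_paths_diff_Suc\<close>.\<close>
  show ?case
    using nbr[of "i + 1" j] nbr[of "i - 1" j] nbr[of i "j + 1"] nbr[of i "j - 1"]
    by (simp add: w_Suc[OF Suc.prems] face_paths_diff_Suc[OF Suc.prems])
qed

theorem theorem34:
  fixes L n :: nat and i j :: int
  assumes "(i, j) \<in> waffle L"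
  shows "int (w L n i j) = int (p_forward L n i j) - int (p_forward L n (i - 1) (j - 1))
    \<and> int (w L n i j) = int (p_backward L n i j) - int (p_backward L n (i - 1) (j - 1))
    \<and> p_forward L n i j = p_backward L n i j"
proof -
  have "p_backward L n = p_forward L n"
    by (simp add: p_backward_def p_forward_def card_backward_paths fun_eq_iff)
  then show ?thesis
    using w_eq_face_paths_diff[OF assms, of n] by (simp add: p_forward_eq)
qed

end
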